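(* For every natural number $r$ there exists a graph $G$ with $r(G)\le r$ and $$\chi(G)\ \ge\ \Big\lfloor \frac{3r}{2}\Big\rfloor-1 .$$
   Context: All graphs are finite, simple, undirected and loopless. $\chi(G)$ is the chromatic number of $G$. A path in $G$ is a (not necessarily induced) subgraph of $G$ that is a path. For a graph $G$, $r(G)$ denotes the maximum of $\chi(G[V(P)])$ over all paths $P$ in $G$, where $G[V(P)]$ is the subgraph of $G$ induced by the vertex set of $P$. *)

theory Defs
  imports Complex_Main "Graph_Theory.Graph_Theory"
begin

text \<open>
  Finite simple undirected graphs are the structures satisfying the locale predicate
  \<^term>\<open>graph\<close>: finite, loopless, symmetric digraphs without parallel arcs, an undirected edge
  being represented by the two opposite arcs.  The null graph is allowed.
\<close>

definition proper_coloring :: "('a, 'b) pre_digraph \<Rightarrow> ('a \<Rightarrow> nat) \<Rightarrow> bool" where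
  "proper_coloring G c \<longleftrightarrow> (\<forall>u v. u \<rightarrow>\<^bsub>G\<^esub> v \<longrightarrow> c u \<noteq> c v)"

definition colorable :: "('a, 'b) pre_digraph \<Rightarrow> nat \<Rightarrow> bool" where
  "colorable G k \<longleftrightarrow> (\<exists>c. proper_coloring G c \<and> c ` verts G \<subseteq> {..<k})"

definition chromatic_number :: "('a, 'b) pre_digraph \<Rightarrow> nat" where
  "chromatic_number G = (LEAST k. colorable G k)"

text \<open>
  The parameter $r(G)$.  A \<^const>\<open>vpath\<close> is a nonempty list of distinct vertices, consecutive ones
  being adjacent.  On type \<^typ>\<open>nat\<close>, \<^const>\<open>Sup\<close> is \<^const>\<open>Max\<close> on nonempty sets, and it is 0 on
  the empty set, which covers the null graph: that graph contains no path.
\<close>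

definition path_chromatic_number :: "('a, 'b) pre_digraph \<Rightarrow> nat" where
  "path_chromatic_number G = (SUP p \<in> {p. vpath p G}. chromatic_number (G \<restriction> set p))"

text \<open>Neither the minimum nor the maximum above degenerates.\<close>

lemma colorable_chromatic_number:
  assumes "graph G"
  shows "colorable G (chromatic_number G)"
proof -
  interpret graph G by fact
  obtain c :: "'a \<Rightarrow> nat" where c: "inj_on c (verts G)"
    using finite_imp_inj_to_nat_seg[OF finite_verts] by blast
  have "proper_coloring G c"
    unfolding proper_coloring_def using c adj_in_verts adj_not_same by (metis inj_on_contraD)
  moreover obtain k where "c ` verts G \<subseteq> {..<k}"
    using finite_nat_bounded[of "c ` verts G"] by auto
  ultimately have "colorable G k"
    unfolding colorable_def by blast
  then show ?thesis
    unfolding chromatic_number_def by (rule LeastI)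
qed

lemma finite_vpaths:
  assumes "graph G"
  shows "finite {p. vpath p G}"
proof -
  interpret graph G by fact
  show ?thesis
    by (rule finite_subset[OF _ finite_subset_distinct[OF finite_verts]])
       (auto simp: vpath_def vwalk_def)
qed

lemma path_chromatic_number_le_iff:
  assumes "graph G"
  shows "path_chromatic_number G \<le> k \<longleftrightarrow> (\<forall>p. vpath p G \<longrightarrow> chromatic_number (G \<restriction> set p) \<le> k)"
  using finite_vpaths[OF assms] by (auto simp: path_chromatic_number_def Sup_nat_def)

lemma path_chromatic_number_attained:
  assumes "graph G" "verts G \<noteq> {}"
  obtains p where "vpath p G" "path_chromatic_number G = chromatic_number (G \<restriction> set p)"
proof -
  let ?S = "(\<lambda>p. chromatic_number (G \<restriction> set p)) ` {p. vpath p G}"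
  obtain v where "v \<in> verts G" using assms by blast
  then have "vpath [v] G" by (auto simp: vpath_def vwalk_def)
  then have "?S \<noteq> {}" by blast
  moreover have "finite ?S" using finite_vpaths[OF assms(1)] by blast
  ultimately have "Sup ?S \<in> ?S" unfolding Sup_nat_def by (metis Max_in)
  then show ?thesis using that unfolding path_chromatic_number_def by auto
qed

end

theory Submission
  imports Defs
begin

text \<open>
  The graphs are built by a step that raises the permitted number \<open>r\<close> of colours on a path by 2
  and the chromatic number by 3.  Starting from the complete graphs on \<open>r < 4\<close> vertices, where
  both numbers are \<open>r\<close>, iteration yields a chromatic number of at least \<open>\<lfloor>3 r / 2\<rfloor> - 1\<close>.

  The step takes a graph \<open>G\<close> and a digraph \<open>H\<close> of large chromatic number, whose vertices are now
  called hubs and are pairwise non-adjacent.  For every arc \<open>e = (u, v)\<close> of \<open>H\<close> there is a block: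
  a copy of \<open>G\<close> joined completely to two adjacent new vertices \<open>Lft e\<close> and \<open>Rgt e\<close>.  The hub \<open>u\<close>
  is adjacent to \<open>Lft e\<close> and the copy, the hub \<open>v\<close> to \<open>Rgt e\<close> and the copy.

  The new graph needs 3 more colours (\<open>more_colors_needed\<close>): with too few colours, some arc
  \<open>(u, v)\<close> of \<open>H\<close> has both ends in one colour, and this colour and those of \<open>Lft e\<close> and \<open>Rgt e\<close>
  are then three distinct colours absent from the copy of \<open>G\<close>.

  On a path, 2 more colours suffice (\<open>path_colorable_blocks\<close>).  If \<open>u\<close> and \<open>v\<close> have different
  colours, \<open>Lft e\<close> can take the colour of \<open>v\<close> and \<open>Rgt e\<close> that of \<open>u\<close>, so that \<open>r\<close> of the
  \<open>r + 2\<close> colours are left for the copy of \<open>G\<close>.  It remains to colour the hubs so that the two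
  ends of every block met by the path differ (\<open>color_hubs\<close>).  A path enters and leaves a block
  only through the two hubs, and it passes through each hub once.  Hence a hub is next to at most
  two blocks on the path, and every block met by the path is next to both of its hubs, except for
  the few blocks that contain an end of the path.  The ends of these exceptional blocks are
  coloured first; all other hubs meet at most two constraints and are coloured greedily.

  Two points make this work as an induction.  The path meets a copy of \<open>G\<close> in several pieces, so
  the induction concerns vertex sets that fall into at most \<open>b + 1\<close> paths, for every \<open>b\<close>, and
  the graph \<open>G\<close> is chosen after \<open>b\<close> (\<open>breaks_filter\<close>).  And the exceptional hubs must be
  colourable with few colours although \<open>H\<close> is not: \<open>H\<close> is a shift graph on long tuples, all of
  whose small subgraphs are 4-colourable (\<open>locally_four_colorable\<close>).  Four colours are available
  because \<open>r \<ge> 2\<close> at every step, which is why the iteration has to start from \<open>r = 2\<close> and \<open>r = 3\<close>.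
\<close>

section \<open>Colourings of relations\<close>

text \<open>
  Stated for relations, colouring covers graphs and the arcs of a digraph alike, and passing to a
  subgraph is only a change of the vertex set.
\<close>

definition proper_on :: "('a \<Rightarrow> 'a \<Rightarrow> bool) \<Rightarrow> 'a set \<Rightarrow> ('a \<Rightarrow> nat) \<Rightarrow> bool" where
  "proper_on E X f \<longleftrightarrow> (\<forall>x\<in>X. \<forall>y\<in>X. E x y \<longrightarrow> f x \<noteq> f y)"

definition colorable_on :: "('a \<Rightarrow> 'a \<Rightarrow> bool) \<Rightarrow> 'a set \<Rightarrow> nat \<Rightarrow> bool" where
  "colorable_on E X k \<longleftrightarrow> (\<exists>f. proper_on E X f \<and> f ` X \<subseteq> {..<k})"

text \<open>
  The colours of a natural construction are sets, or what remains of a palette after removing some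
  of its elements; only the number of available colours matters.
\<close>

lemma colorable_onI:
  fixes f :: "'a \<Rightarrow> 'c"
  assumes "finite K" "card K \<le> k"
    and "\<And>x. x \<in> X \<Longrightarrow> f x \<in> K"
    and "\<And>x y. x \<in> X \<Longrightarrow> y \<in> X \<Longrightarrow> E x y \<Longrightarrow> f x \<noteq> f y"
  shows "colorable_on E X k"
proof -
  obtain h :: "_ \<Rightarrow> nat" where h: "inj_on h K" "h ` K \<subseteq> {..<k}"
    using card_le_inj[of K "{..<k}"] assms(1,2) by auto
  have "proper_on E X (h \<circ> f)"
    unfolding proper_on_def using assms(3,4) h(1) by (metis comp_apply inj_onD)
  moreover have "(h \<circ> f) ` X \<subseteq> {..<k}" using h(2) assms(3) by auto
  ultimately show ?thesis unfolding colorable_on_def by blast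
qed

lemma colorable_on_mono: "colorable_on E X k \<Longrightarrow> k \<le> l \<Longrightarrow> colorable_on E X l"
  unfolding colorable_on_def by fastforce

lemma colorable_on_vimage:
  assumes "colorable_on E' Y k" "f ` X \<subseteq> Y"
    and "\<And>x y. x \<in> X \<Longrightarrow> y \<in> X \<Longrightarrow> E x y \<Longrightarrow> E' (f x) (f y)"
  shows "colorable_on E X k"
proof -
  obtain c where c: "proper_on E' Y c" "c ` Y \<subseteq> {..<k}"
    using assms(1) unfolding colorable_on_def by blast
  show ?thesis
    by (rule colorable_onI[of "{..<k}" _ _ "c \<circ> f"])
       (use c assms(2,3) in \<open>auto simp: proper_on_def image_subset_iff\<close>)
qed

text \<open>
  Vertices outside \<open>W\<close> are added one at a time; each has fewer than \<open>k\<close> neighbours in all of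
  \<open>S\<close>, so a colour is always free.
\<close>

lemma greedy_extension:
  assumes "finite S" "W \<subseteq> S" "colorable_on F W k" "symp F"
    and irrefl: "\<And>v. v \<in> S \<Longrightarrow> \<not> F v v"
    and deg: "\<And>v. v \<in> S - W \<Longrightarrow> card {z \<in> S. F v z} < k"
  shows "colorable_on F S k"
proof -
  have "colorable_on F (W \<union> D) k" if "finite D" "D \<subseteq> S - W" for D
    using that
  proof (induction D rule: finite_induct)
    case empty
    then show ?case using assms(3) by simp
  next
    case (insert v D)
    then obtain f where f: "proper_on F (W \<union> D) f" "f ` (W \<union> D) \<subseteq> {..<k}"
      unfolding colorable_on_def by auto
    have v: "v \<in> S - W" "v \<notin> W \<union> D" using insert by auto
    have "card (f ` {z \<in> S. F v z}) < k"
      using deg[OF v(1)] card_image_le[of "{z \<in> S. F v z}" f] assms(1) by simp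
    then have "\<not> {..<k} \<subseteq> f ` {z \<in> S. F v z}"
      using card_mono[of "f ` {z \<in> S. F v z}" "{..<k}"] assms(1) by auto
    then obtain a where a: "a < k" "a \<notin> f ` {z \<in> S. F v z}" by auto
    have sub: "W \<union> D \<subseteq> S" using assms(2) insert by auto
    have "proper_on F (W \<union> insert v D) (f(v := a))"
      unfolding proper_on_def
    proof (intro ballI impI)
      fix x y assume xy: "x \<in> W \<union> insert v D" "y \<in> W \<union> insert v D" "F x y"
      consider "x = v" "y = v" | "x = v" "y \<in> W \<union> D" "y \<noteq> v" | "y = v" "x \<in> W \<union> D" "x \<noteq> v"
        | "x \<in> W \<union> D" "y \<in> W \<union> D" "x \<noteq> v" "y \<noteq> v"
        using xy v(2) by blast
      then show "(f(v := a)) x \<noteq> (f(v := a)) y"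
      proof cases
        case 1
        then show ?thesis using xy irrefl v by auto
      next
        case 2
        then show ?thesis using xy a sub by auto
      next
        case 3
        then have "F v x" using xy \<open>symp F\<close> by (auto dest: sympD)
        then show ?thesis using 3 a sub by auto
      next
        case 4
        then show ?thesis using f(1) xy(3) unfolding proper_on_def by auto
      qed
    qed
    moreover have "(f(v := a)) ` (W \<union> insert v D) \<subseteq> {..<k}"
      using f(2) a by auto
    ultimately show ?case unfolding colorable_on_def by blast
  qed
  from this[of "S - W"] show ?thesis
    using assms(1,2) by (simp add: Un_absorb1)
qed

section \<open>Shift graphs\<close>

text \<open>
  The shift digraph on increasing \<open>n\<close>-tuples joins a tuple to every tuple obtained by dropping its
  first entry and appending a larger one.  Its arcs thus correspond to the increasing tuples
  of length \<open>n + 1\<close>, which are the vertices of the next shift digraph.  Passing from one to the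
  next lowers the chromatic number at most logarithmically and, on the other hand, at least to
  about its square root.
\<close>

definition tuples :: "nat set \<Rightarrow> nat \<Rightarrow> nat list set" where
  "tuples R n = {xs. length xs = n \<and> sorted_wrt (<) xs \<and> set xs \<subseteq> R}"

text \<open>
  Taking the tuple of length \<open>n + 1\<close> as witness, instead of demanding \<open>tl xs = butlast ys\<close>, also
  gives the right relation for \<open>n = 1\<close>, namely the order on the entries.
\<close>

definition shift :: "nat list \<Rightarrow> nat list \<Rightarrow> bool" where
  "shift xs ys \<longleftrightarrow> (\<exists>zs. sorted_wrt (<) zs \<and> zs \<noteq> [] \<and> xs = butlast zs \<and> ys = tl zs)"

lemma finite_tuples: "finite R \<Longrightarrow> finite (tuples R n)"
  by (rule finite_subset[OF _ finite_lists_length_eq[of R n]]) (auto simp: tuples_def)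

lemma sorted_wrt_butlast: "sorted_wrt P zs \<Longrightarrow> sorted_wrt P (butlast zs)"
  by (cases zs rule: rev_cases) (auto simp: sorted_wrt_append)

lemma sorted_wrt_tl: "sorted_wrt P zs \<Longrightarrow> sorted_wrt P (tl zs)"
  by (cases zs) auto

lemma tuples_butlast: "zs \<in> tuples R (Suc n) \<Longrightarrow> butlast zs \<in> tuples R n"
  by (auto simp: tuples_def sorted_wrt_butlast dest: in_set_butlastD)

lemma tuples_tl: "zs \<in> tuples R (Suc n) \<Longrightarrow> tl zs \<in> tuples R n"
  by (cases zs) (auto simp: tuples_def)

lemma shift_tuplesE:
  assumes "shift xs ys" "xs \<in> tuples R (Suc n)" "ys \<in> tuples R (Suc n)"
  obtains zs where "zs \<in> tuples R (Suc (Suc n))" "xs = butlast zs" "ys = tl zs"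
proof -
  obtain zs where zs: "sorted_wrt (<) zs" "zs \<noteq> []" "xs = butlast zs" "ys = tl zs"
    using assms(1) unfolding shift_def by blast
  obtain z zs' where z: "zs = z # zs'" using zs by (cases zs) auto
  have "length zs = Suc (Suc n)" using zs(4) assms(3) z by (simp add: tuples_def)
  moreover have "z \<in> set xs" using zs(3) z calculation by (cases zs') auto
  then have "set zs \<subseteq> R" using assms(2,3) zs z by (auto simp: tuples_def)
  ultimately show ?thesis using that zs by (auto simp: tuples_def)
qed

lemma tuples_shift: "zs \<in> tuples R (Suc n) \<Longrightarrow> shift (butlast zs) (tl zs)"
  by (auto simp: tuples_def shift_def)

text \<open>
  A tuple receives the set of colours of all its extensions by one entry.  If \<open>zs\<close> is the arc from
  \<open>xs\<close> to \<open>ys\<close>, then the colour of \<open>zs\<close> belongs to the set of \<open>xs\<close>; it is not in that of \<open>ys\<close>,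
  as \<open>zs\<close> is joined to every extension of \<open>ys\<close>.
\<close>

lemma shift_colorable_pred:
  assumes "colorable_on shift (tuples R (Suc (Suc n))) k"
  shows "colorable_on shift (tuples R (Suc n)) (2 ^ k)"
proof -
  obtain f where f: "proper_on shift (tuples R (Suc (Suc n))) f" "f ` tuples R (Suc (Suc n)) \<subseteq> {..<k}"
    using assms unfolding colorable_on_def by blast
  define g where "g xs = {f zs |zs. zs \<in> tuples R (Suc (Suc n)) \<and> butlast zs = xs}" for xs
  show ?thesis
  proof (rule colorable_onI[of "Pow {..<k}" _ _ g])
    fix xs ys assume *: "xs \<in> tuples R (Suc n)" "ys \<in> tuples R (Suc n)" "shift xs ys"
    then obtain zs where zs: "zs \<in> tuples R (Suc (Suc n))" "xs = butlast zs" "ys = tl zs"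
      by (metis shift_tuplesE)
    show "g xs \<noteq> g ys"
    proof
      assume "g xs = g ys"
      moreover have "f zs \<in> g xs" using zs unfolding g_def by blast
      ultimately obtain ws where ws: "ws \<in> tuples R (Suc (Suc n))" "butlast ws = ys" "f ws = f zs"
        unfolding g_def by force
      have "shift zs ws"
      proof -
        have "length ws = Suc (Suc n)" "length zs = Suc (Suc n)" "length ys = Suc n"
          using ws(1) zs(1) *(2) by (simp_all add: tuples_def)
        then have ne: "ws \<noteq> []" "zs \<noteq> []" "ys \<noteq> []" by auto
        have w: "ws = ys @ [last ws]" using ws ne by (metis append_butlast_last_id)
        have z: "zs = hd zs # ys" using zs ne by simp
        have "sorted_wrt (<) (hd zs # ws)"
        proof -
          have s: "sorted_wrt (<) ws" "sorted_wrt (<) (hd zs # ys)" using ws(1) zs(1) z by (auto simp: tuples_def)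
          have "hd zs < hd ys" using s(2) ne by (cases ys) auto
          moreover have "hd ys < last ws" using s(1) w ne by (metis list.set_sel(1) list.set_intros(1) sorted_wrt_append)
          ultimately have "hd zs < last ws" by simp
          moreover have "set ws = insert (last ws) (set ys)" by (subst w) simp
          ultimately show ?thesis using s by simp
        qed
        moreover have "butlast (hd zs # ws) = zs" using ne ws(2) z by simp
        ultimately show ?thesis unfolding shift_def by (metis list.sel(3) list.distinct(1))
      qed
      then show False using f(1) ws zs unfolding proper_on_def by metis
    qed
  qed (use f in \<open>auto simp: g_def card_Pow\<close>)
qed

lemma shift_not_colorable:
  "\<exists>M. \<not> colorable_on shift (tuples {..<M} (Suc n)) k"
proof (induction n arbitrary: k)
  case 0
  have "\<not> colorable_on shift (tuples {..<Suc k} (Suc 0)) k"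
  proof
    assume "colorable_on shift (tuples {..<Suc k} (Suc 0)) k"
    then obtain f where f: "proper_on shift (tuples {..<Suc k} (Suc 0)) f" "f ` tuples {..<Suc k} (Suc 0) \<subseteq> {..<k}"
      unfolding colorable_on_def by blast
    have T: "[x] \<in> tuples {..<Suc k} (Suc 0)" if "x < Suc k" for x
      using that by (auto simp: tuples_def)
    have ne: "f [x] \<noteq> f [y]" if "x < y" "y < Suc k" for x y
    proof -
      have "shift [x] [y]" unfolding shift_def by (rule exI[of _ "[x, y]"]) (use that in auto)
      then show ?thesis using f(1) T that unfolding proper_on_def by (meson less_trans)
    qed
    have "inj_on (\<lambda>x. f [x]) {..<Suc k}"
      by (rule linorder_inj_onI) (use ne in auto)
    moreover have "(\<lambda>x. f [x]) ` {..<Suc k} \<subseteq> {..<k}" using f(2) T by blast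
    ultimately have "card {..<Suc k} \<le> card {..<k}" by (rule card_inj_on_le) simp
    then show False by simp
  qed
  then show ?case by blast
next
  case (Suc n)
  then show ?case using shift_colorable_pred by blast
qed

text \<open>
  Represent the \<open>l\<close> colours by distinct 2-subsets of \<open>m\<close> new colours.  An arc receives a new colour
  that belongs to the 2-set of its tail but not to that of its head.  For two consecutive arcs,
  the 2-set of their common vertex then contains the second new colour but not the first.
\<close>

lemma shift_colorable_Suc:
  assumes "colorable_on shift (tuples R (Suc n)) l" "l \<le> m choose 2"
  shows "colorable_on shift (tuples R (Suc (Suc n))) m"
proof -
  obtain g where g: "proper_on shift (tuples R (Suc n)) g" "g ` tuples R (Suc n) \<subseteq> {..<l}"
    using assms(1) unfolding colorable_on_def by blast
  have "card {A. A \<subseteq> {..<m} \<and> card A = 2} = m choose 2" using n_subsets[of "{..<m}" 2] by simp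
  then obtain P where P: "inj_on P {..<l}" "P ` {..<l} \<subseteq> {A. A \<subseteq> {..<m} \<and> card A = 2}"
    using card_le_inj[of "{..<l}" "{A. A \<subseteq> {..<m} \<and> card A = 2}"] assms(2) by auto
  have "\<exists>a. a \<in> P (g (butlast zs)) - P (g (tl zs))" if "zs \<in> tuples R (Suc (Suc n))" for zs
  proof -
    have t: "butlast zs \<in> tuples R (Suc n)" "tl zs \<in> tuples R (Suc n)" "shift (butlast zs) (tl zs)"
      using that tuples_butlast tuples_tl tuples_shift by blast+
    then have lt: "g (butlast zs) \<in> {..<l}" "g (tl zs) \<in> {..<l}" using g(2) by blast+
    have "g (butlast zs) \<noteq> g (tl zs)" using t g(1) unfolding proper_on_def by blast
    then have ne: "P (g (butlast zs)) \<noteq> P (g (tl zs))" using P(1) lt by (meson inj_onD)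
    have c: "card (P (g (butlast zs))) = 2" "card (P (g (tl zs))) = 2" using P(2) lt by blast+
    then have "finite (P (g (tl zs)))" by (metis card.infinite zero_neq_numeral)
    then have "\<not> P (g (butlast zs)) \<subseteq> P (g (tl zs))" using ne c by (metis card_subset_eq)
    then show ?thesis by blast
  qed
  then obtain h where h: "\<And>zs. zs \<in> tuples R (Suc (Suc n)) \<Longrightarrow> h zs \<in> P (g (butlast zs)) - P (g (tl zs))"
    by metis
  show ?thesis
  proof (rule colorable_onI[of "{..<m}" _ _ h])
    fix zs assume "zs \<in> tuples R (Suc (Suc n))"
    then show "h zs \<in> {..<m}"
      using h[of zs] P(2) g(2) tuples_butlast[of zs] by blast
  next
    fix xs ys assume *: "xs \<in> tuples R (Suc (Suc n))" "ys \<in> tuples R (Suc (Suc n))" "shift xs ys"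
    then have "tl xs = butlast ys" unfolding shift_def by (auto simp: butlast_tl)
    then show "h xs \<noteq> h ys" using h[OF *(1)] h[OF *(2)] by auto
  qed auto
qed

text \<open>
  The first step brings the number of colours down from \<open>card R\<close> to \<open>n + 3\<close>.  Every further step
  saves at least one colour as long as there are five or more, because \<open>m + 1 \<le> m choose 2\<close> for
  \<open>m \<ge> 4\<close>.
\<close>

lemma shift_four_colorable:
  assumes "finite R" "card R \<le> (n + 3) choose 2" "n \<ge> 1"
  shows "colorable_on shift (tuples R (Suc n)) 4"
proof -
  have "colorable_on shift (tuples R (Suc (Suc i))) (n + 3 - i)" if "i < n" for i
    using that
  proof (induction i)
    case 0
    have "colorable_on shift (tuples R (Suc 0)) (card R)"
    proof (rule colorable_onI[OF assms(1) le_refl, of _ hd])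
      fix xs assume "xs \<in> tuples R (Suc 0)"
      then show "hd xs \<in> R" by (cases xs) (auto simp: tuples_def)
    next
      fix xs ys assume "xs \<in> tuples R (Suc 0)" "ys \<in> tuples R (Suc 0)" "shift xs ys"
      then obtain zs where "zs \<in> tuples R (Suc (Suc 0))" "xs = butlast zs" "ys = tl zs"
        by (metis shift_tuplesE)
      then show "hd xs \<noteq> hd ys" by (auto simp: tuples_def length_Suc_conv)
    qed
    from shift_colorable_Suc[OF this assms(2)] show ?case by simp
  next
    case (Suc i)
    then have IH: "colorable_on shift (tuples R (Suc (Suc i))) (n + 3 - i)" by simp
    obtain l where l: "n = i + 2 + l" using Suc.prems le_Suc_ex[of "i + 2" n] by auto
    have "2 * (l + 5) \<le> (l + 4) * (l + 3)" by (simp add: algebra_simps)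
    then have "l + 5 \<le> (l + 4) * (l + 3) div 2"
      using div_le_mono[of "2 * (l + 5)" "(l + 4) * (l + 3)" 2] by simp
    then have "l + 5 \<le> (l + 4) choose 2" by (simp add: choose_two mult.commute add.commute)
    then show ?case
      using shift_colorable_Suc[OF IH, of "n + 3 - Suc i"] l by (simp add: add.commute)
  qed
  from this[of "n - 1"] show ?thesis using assms(3) by simp
qed

text \<open>
  At most \<open>N\<close> tuples of length \<open>n + 1\<close> involve at most \<open>N (n + 1)\<close> entries.  This is linear in \<open>n\<close>,
  whereas \<open>shift_four_colorable\<close> admits quadratically many entries; so \<open>n\<close> about \<open>2 N\<close> suffices,
  whatever the range \<open>M\<close> of the entries.
\<close>

lemma locally_four_colorable:
  "\<exists>S :: nat list set. finite S \<and> \<not> colorable_on shift S k \<and>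
     (\<forall>U \<subseteq> S. card U \<le> N \<longrightarrow> colorable_on shift U 4)"
proof -
  define n where "n = 2 * N + 1"
  obtain M where M: "\<not> colorable_on shift (tuples {..<M} (Suc n)) k"
    using shift_not_colorable by blast
  have fin: "finite (tuples {..<M} (Suc n))" by (simp add: finite_tuples)
  moreover have "colorable_on shift U 4" if U: "U \<subseteq> tuples {..<M} (Suc n)" "card U \<le> N" for U
  proof -
    define R where "R = (\<Union>xs\<in>U. set xs)"
    have finU: "finite U" using U(1) fin finite_subset by blast
    have "card R \<le> (\<Sum>xs\<in>U. card (set xs))" unfolding R_def by (rule card_UN_le[OF finU])
    also have "\<dots> \<le> (\<Sum>xs\<in>U. Suc n)"
      by (rule sum_mono) (use U(1) in \<open>auto simp: tuples_def subset_iff intro: card_length[THEN order_trans]\<close>)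
    also have "\<dots> \<le> N * Suc n" using mult_le_mono1[OF U(2), of "Suc n"] by simp
    also have "\<dots> \<le> (n + 3) choose 2"
    proof -
      have "(n + 3) choose 2 = (N + 2) * (2 * N + 3)"
        by (simp add: n_def choose_two algebra_simps)
      then show ?thesis by (simp add: n_def algebra_simps)
    qed
    finally have "colorable_on shift (tuples R (Suc n)) 4"
      by (intro shift_four_colorable) (auto simp: R_def finU n_def)
    moreover have "U \<subseteq> tuples R (Suc n)" using U(1) by (auto simp: tuples_def R_def)
    ultimately show ?thesis using colorable_on_vimage[of shift _ 4 "\<lambda>x. x" U] by auto
  qed
  ultimately show ?thesis using M by blast
qed


section \<open>Vertex lists with few breaks\<close>

text \<open>
  A distinct list with \<open>b\<close> breaks lists the vertices of \<open>b + 1\<close> disjoint paths.  Unlike a path,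
  such a list can be restricted to part of the graph.
\<close>

fun breaks :: "('a \<Rightarrow> 'a \<Rightarrow> bool) \<Rightarrow> 'a list \<Rightarrow> nat" where
  "breaks E (x # y # xs) = (if E x y then 0 else 1) + breaks E (y # xs)"
| "breaks E _ = 0"

lemma breaks_map_cong:
  "(\<And>x y. x \<in> set p \<Longrightarrow> y \<in> set p \<Longrightarrow> E' (f x) (f y) \<longleftrightarrow> E x y) \<Longrightarrow> breaks E' (map f p) = breaks E p"
  by (induction p rule: induct_list012) auto

lemma breaks_conv_card:
  "card {i. Suc i < length p \<and> \<not> E (p ! i) (p ! Suc i)} = breaks E p"
proof (induction p rule: induct_list012)
  case (3 x y xs)
  let ?B = "\<lambda>p. {i. Suc i < length p \<and> \<not> E (p ! i) (p ! Suc i)}"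
  have eq: "?B (x # y # xs) = (if E x y then {} else {0}) \<union> Suc ` ?B (y # xs)" (is "_ = ?R")
  proof (rule set_eqI)
    fix i show "i \<in> ?B (x # y # xs) \<longleftrightarrow> i \<in> ?R" by (cases i) auto
  qed
  have "finite (?B (y # xs))" by (rule finite_subset[of _ "{..<length (y # xs)}"]) auto
  then have "card (?B (x # y # xs)) = (if E x y then 0 else 1) + card (?B (y # xs))"
    unfolding eq by (subst card_Un_disjoint) (auto simp: card_image)
  then show ?case using 3 by simp
qed auto

text \<open>
  A break of the restricted list either is an old one or bridges a gap.  A gap is opened by a
  break or by a step out of \<open>P\<close>, and such a step leads to an element of \<open>D\<close>.
\<close>

lemma breaks_filter:
  assumes exit: "\<And>x y. E x y \<Longrightarrow> P x \<Longrightarrow> \<not> P y \<Longrightarrow> y \<in> D"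
  shows "breaks E (filter P p) \<le> breaks E p + length (filter (\<lambda>x. x \<in> D) p)"
proof -
  \<comment> \<open>The first part treats the lists read while inside a gap, \<open>w\<close> being the last vertex before it.\<close>
  have step: "breaks E (w # filter P xs) \<le> Suc (breaks E xs + length (filter (\<lambda>x. x \<in> D) xs)) \<and>
      (P x \<longrightarrow> breaks E (x # filter P xs) \<le> breaks E (x # xs) + length (filter (\<lambda>x. x \<in> D) xs))"
    for w x xs
  proof (induction xs arbitrary: w x)
    case (Cons y ys)
    have mono: "breaks E ys \<le> breaks E (y # ys)" by (cases ys) auto
    show ?case
    proof (cases "P y")
      case True
      then show ?thesis using Cons[of w y] by (auto split: if_splits)
    next
      case False
      then show ?thesis using Cons[of w y] Cons[of x y] exit[of x y] mono by auto
    qed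
  qed auto
  show ?thesis
  proof (induction p)
    case (Cons x xs)
    have "breaks E xs \<le> breaks E (x # xs)" by (cases xs) auto
    then show ?case using Cons step[where x = x and xs = xs] by (cases "P x") fastforce+
  qed simp
qed

lemma breaks_filter_distinct:
  assumes "\<And>x y. E x y \<Longrightarrow> P x \<Longrightarrow> \<not> P y \<Longrightarrow> y \<in> D" "distinct p" "finite D"
  shows "breaks E (filter P p) \<le> breaks E p + card D"
proof -
  have "length (filter (\<lambda>x. x \<in> D) p) = card (set p \<inter> D)"
    using distinct_card[of "filter (\<lambda>x. x \<in> D) p"] assms(2) by (simp add: Int_def)
  also have "\<dots> \<le> card D" using assms(3) by (simp add: card_mono)
  finally show ?thesis using breaks_filter[of E P D p] assms(1) by force
qed

section \<open>Attaching blocks to the arcs of a sparse graph\<close>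

text \<open>
  \<open>Lft e\<close>, \<open>Rgt e\<close> and the \<open>Inn e g\<close> form the block of the arc \<open>e\<close>; the \<open>Inn e g\<close> are its copy of
  the previous graph.
\<close>

datatype ('s, 'g) vertex =
    Hub 's
  | Lft "'s \<times> 's"
  | Rgt "'s \<times> 's"
  | Inn "'s \<times> 's" 'g

fun block :: "('s, 'g) vertex \<Rightarrow> ('s \<times> 's) option" where
  "block (Hub s) = None"
| "block (Lft e) = Some e"
| "block (Rgt e) = Some e"
| "block (Inn e g) = Some e"

fun link :: "('g \<Rightarrow> 'g \<Rightarrow> bool) \<Rightarrow> ('s, 'g) vertex \<Rightarrow> ('s, 'g) vertex \<Rightarrow> bool" where
  "link E (Hub s) (Lft e) = (s = fst e)"
| "link E (Hub s) (Rgt e) = (s = snd e)"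
| "link E (Hub s) (Inn e g) = (s = fst e \<or> s = snd e)"
| "link E (Lft e) (Rgt e') = (e = e')"
| "link E (Lft e) (Inn e' g) = (e = e')"
| "link E (Rgt e) (Inn e' g) = (e = e')"
| "link E (Inn e g) (Inn e' g') = (e = e' \<and> E g g')"
| "link E _ _ = False"

definition adj :: "('g \<Rightarrow> 'g \<Rightarrow> bool) \<Rightarrow> ('s, 'g) vertex \<Rightarrow> ('s, 'g) vertex \<Rightarrow> bool" where
  "adj E x y \<longleftrightarrow> link E x y \<or> link E y x"

definition vertices :: "('s \<Rightarrow> 's \<Rightarrow> bool) \<Rightarrow> 's set \<Rightarrow> 'g set \<Rightarrow> ('s, 'g) vertex set" where
  "vertices A S V =
     Hub ` S \<union> (\<Union>e \<in> {e \<in> S \<times> S. A (fst e) (snd e)}. insert (Lft e) (insert (Rgt e) (Inn e ` V)))"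

lemma finite_vertices: "finite S \<Longrightarrow> finite V \<Longrightarrow> finite (vertices A S V)"
  by (auto simp: vertices_def)

lemma symp_adj: "symp (adj E)"
  by (auto simp: adj_def intro: sympI)

lemma irreflp_adj: "irreflp E \<Longrightarrow> irreflp (adj E)"
proof (rule irreflpI)
  fix x assume "irreflp E"
  then show "\<not> adj E x x" by (cases x) (auto simp: adj_def dest: irreflpD)
qed

lemma adj_leave_block:
  assumes "adj E x y" "block x = Some e" "block y \<noteq> Some e"
  shows "y \<in> {Hub (fst e), Hub (snd e)}"
  using assms by (cases x; cases y) (auto simp: adj_def)

lemma vertices_block:
  assumes "x \<in> vertices A S V" "block x = Some e"
  shows "fst e \<in> S" "snd e \<in> S" "A (fst e) (snd e)"
  using assms by (auto simp: vertices_def)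

text \<open>
  Since \<open>c + 2\<close> colours do not suffice for \<open>A\<close>, a colouring with that many would give both ends of
  some arc the same colour.  The whole copy of \<open>E\<close> sees this colour and those of \<open>Lft\<close> and \<open>Rgt\<close>,
  which leaves it fewer than \<open>c\<close> colours.
\<close>

lemma more_colors_needed:
  assumes fin: "finite V" "finite S"
    and H: "\<not> colorable_on A S (c + 2)"
    and G: "\<And>k. colorable_on E V k \<Longrightarrow> c \<le> k"
    and sym: "symp E"
    and k: "colorable_on (adj E) (vertices A S V) k"
  shows "c + 3 \<le> k"
proof (rule ccontr)
  assume less: "\<not> c + 3 \<le> k"
  obtain f where f: "proper_on (adj E) (vertices A S V) f" "f ` vertices A S V \<subseteq> {..<k}"
    using k unfolding colorable_on_def by blast
  have "\<not> colorable_on A S k" using H less colorable_on_mono[of A S k "c + 2"] by linarith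
  moreover have "(f \<circ> Hub) ` S \<subseteq> {..<k}" using f(2) by (auto simp: vertices_def)
  ultimately have "\<not> proper_on A S (f \<circ> Hub)" unfolding colorable_on_def by blast
  then obtain u v where uv: "u \<in> S" "v \<in> S" "A u v" "f (Hub u) = f (Hub v)"
    unfolding proper_on_def by auto
  let ?e = "(u, v)"
  have mem: "Hub u \<in> vertices A S V" "Hub v \<in> vertices A S V" "Lft ?e \<in> vertices A S V" "Rgt ?e \<in> vertices A S V"
    "\<And>g. g \<in> V \<Longrightarrow> Inn ?e g \<in> vertices A S V"
    using uv by (auto simp: vertices_def)
  have ne: "f x \<noteq> f y" if "x \<in> vertices A S V" "y \<in> vertices A S V" "link E x y" for x y
    using f(1) that unfolding proper_on_def adj_def by blast
  let ?L = "{f (Hub u), f (Lft ?e), f (Rgt ?e)}"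
  have dist: "f (Hub u) \<noteq> f (Lft ?e)" "f (Hub u) \<noteq> f (Rgt ?e)" "f (Lft ?e) \<noteq> f (Rgt ?e)"
    using ne[of "Hub u" "Lft ?e"] ne[of "Hub v" "Rgt ?e"] ne[of "Lft ?e" "Rgt ?e"] mem uv by auto
  have L: "?L \<subseteq> {..<k}" "card ?L = 3" using f(2) mem dist by auto
  have k3: "3 \<le> k" using card_mono[OF _ L(1)] L(2) by simp
  have "colorable_on E V (k - 3)"
  proof (rule colorable_onI[of "{..<k} - ?L" _ _ "\<lambda>g. f (Inn ?e g)"])
    show "card ({..<k} - ?L) \<le> k - 3" using L by (subst card_Diff_subset) auto
  next
    fix g assume "g \<in> V"
    then show "f (Inn ?e g) \<in> {..<k} - ?L"
      using ne[of "Hub u" "Inn ?e g"] ne[of "Lft ?e" "Inn ?e g"] ne[of "Rgt ?e" "Inn ?e g"] mem f(2)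
      by fastforce
  next
    fix g h assume "g \<in> V" "h \<in> V" "E g h"
    then show "f (Inn ?e g) \<noteq> f (Inn ?e h)"
      using ne[of "Inn ?e g" "Inn ?e h"] mem by auto
  qed simp
  then show False using G[of "k - 3"] less k3 by linarith
qed

text \<open>
  Call a block bad if it contains an end of one of the paths that make up \<open>p\<close>.  There are at most
  \<open>2 b + 2\<close> such ends, hence at most \<open>4 b + 4\<close> ends of bad arcs.  In a block that is met by \<open>p\<close>
  but not bad, the path goes on before the first and after the last vertex of the block; it does so
  through two distinct hubs, which are then the two ends of the arc.  So a hub that is no end of a
  bad arc shares a visited block only with the hubs on the other side of its two neighbours in \<open>p\<close>.
\<close>

lemma color_hubs:
  assumes p: "distinct p" "set p \<subseteq> vertices A S V" "breaks (adj E) p \<le> b"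
    and finS: "finite S"
    and loc: "\<And>U. U \<subseteq> S \<Longrightarrow> card U \<le> 4 * b + 4 \<Longrightarrow> colorable_on A U k"
    and k: "3 \<le> k"
  obtains \<phi> where "\<And>s. s \<in> S \<Longrightarrow> \<phi> s < k"
    and "\<And>x e. x \<in> set p \<Longrightarrow> block x = Some e \<Longrightarrow> \<phi> (fst e) \<noteq> \<phi> (snd e)"
proof -
  define visited where "visited = {e. \<exists>x \<in> set p. block x = Some e}"
  define B where "B = {i. Suc i < length p \<and> \<not> adj E (p ! i) (p ! Suc i)}"
  \<comment> \<open>Contains the positions of all ends: those of the list, and those before and after a break.\<close>
  define T where "T = {0, length p - 1} \<union> B \<union> Suc ` B"
  define bad where "bad = {e. \<exists>i \<in> T. i < length p \<and> block (p ! i) = Some e}"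
  define W where "W = fst ` bad \<union> snd ` bad"
  have vis: "fst e \<in> S" "snd e \<in> S" "A (fst e) (snd e)" if "e \<in> visited" for e
    using that p(2) vertices_block unfolding visited_def by blast+
  have finB: "finite B" unfolding B_def by (rule finite_subset[of _ "{..<length p}"]) auto
  have cardB: "card B \<le> b" unfolding B_def using breaks_conv_card p(3) by metis
  have finT: "finite T" using finB by (simp add: T_def)
  have "card T \<le> card {0, length p - 1} + card B + card (Suc ` B)"
    unfolding T_def by (meson card_Un_le add_le_mono1 order_trans)
  also have "\<dots> \<le> 2 + b + b"
    using cardB card_image_le[OF finB, of Suc] card_insert_le_m1[of 2 "{length p - 1}" 0] by simp
  finally have cardT: "card T \<le> 2 * b + 2" by simp
  have bad_sub: "bad \<subseteq> (\<lambda>i. the (block (p ! i))) ` T"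
    unfolding bad_def by force
  have finbad: "finite bad" using bad_sub finT by (meson finite_imageI finite_subset)
  have "card bad \<le> card T"
    using card_mono[OF _ bad_sub] card_image_le[OF finT, of "\<lambda>i. the (block (p ! i))"] finT by fastforce
  then have cardW: "card W \<le> 4 * b + 4"
    using card_Un_le[of "fst ` bad" "snd ` bad"] card_image_le[OF finbad, of fst]
      card_image_le[OF finbad, of snd] cardT unfolding W_def by linarith
  have "bad \<subseteq> visited" unfolding bad_def visited_def by auto
  then have WS: "W \<subseteq> S" using vis unfolding W_def by blast
  define F where "F x y \<longleftrightarrow> (x, y) \<in> visited \<or> (y, x) \<in> visited" for x y
  have symF: "symp F" by (auto simp: F_def intro: sympI)
  \<comment> \<open>A loop would prevent any colouring of the set \<open>{v}\<close>.\<close>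
  have irr: "\<not> A v v" if "v \<in> S" for v
    using loc[of "{v}"] that by (auto simp: colorable_on_def proper_on_def)
  have irrF: "\<not> F v v" if "v \<in> S" for v
    using vis(3)[of "(v, v)"] irr[OF that] unfolding F_def by auto
  have "colorable_on A W k" using loc WS cardW by blast
  then have colW: "colorable_on F W k"
    unfolding colorable_on_def proper_on_def F_def using vis(3) by (metis fst_conv snd_conv)
  \<comment> \<open>Here \<open>i - 1\<close> is truncated, hence the condition \<open>0 < i\<close>.\<close>
  define near where "near v e \<longleftrightarrow> (\<exists>i < length p. p ! i = Hub v \<and>
     (Suc i < length p \<and> block (p ! Suc i) = Some e \<or> 0 < i \<and> block (p ! (i - 1)) = Some e))" for v e
  have near: "near (fst e) e \<and> near (snd e) e" if "e \<in> visited - bad" for e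
  proof -
    define I where "I = {i. i < length p \<and> block (p ! i) = Some e}"
    have finI: "finite I" by (simp add: I_def)
    have neI: "I \<noteq> {}" using that by (auto simp: I_def visited_def in_set_conv_nth)
    have IT: "i \<notin> T" if "i \<in> I" for i using that \<open>e \<in> visited - bad\<close> by (auto simp: I_def bad_def)
    define m where "m = Max I"
    define l where "l = Min I"
    have m: "m \<in> I" "Suc m \<notin> I" unfolding m_def using Max_in[OF finI neI] Max_ge[OF finI, of "Suc (Max I)"] by auto
    have l: "l \<in> I" "l \<le> m" unfolding l_def m_def using finI neI by auto
    have l': "l - 1 \<notin> I" if "0 < l" using Min_le[OF finI, of "l - 1"] that unfolding l_def by linarith
    have "m \<notin> T" "l \<notin> T" using IT m l by auto
    then have *: "m \<noteq> length p - 1" "m \<notin> B" "l \<noteq> 0" "l - 1 \<notin> B"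
      unfolding T_def by (auto simp: image_iff)
    have m1: "Suc m < length p" using m(1) *(1) by (auto simp: I_def)
    have "adj E (p ! m) (p ! Suc m)" using *(2) m1 by (simp add: B_def)
    then have em: "p ! Suc m \<in> {Hub (fst e), Hub (snd e)}"
      by (rule adj_leave_block) (use m m1 in \<open>auto simp: I_def\<close>)
    have l1: "l < length p" "0 < l" using l(1) *(3) by (auto simp: I_def)
    have "adj E (p ! (l - 1)) (p ! l)" using *(4) l1 by (simp add: B_def)
    then have "adj E (p ! l) (p ! (l - 1))" using symp_adj by (metis sympD)
    then have el: "p ! (l - 1) \<in> {Hub (fst e), Hub (snd e)}"
      by (rule adj_leave_block) (use l(1) l' l1 in \<open>auto simp: I_def\<close>)
    have ne: "p ! (l - 1) \<noteq> p ! Suc m"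
      using nth_eq_iff_index_eq[OF p(1), of "l - 1" "Suc m"] l1 l m1 by auto
    have near_m: "near v e" if "p ! Suc m = Hub v" for v
      unfolding near_def by (rule exI[of _ "Suc m"]) (use that m1 m in \<open>auto simp: I_def\<close>)
    have near_l: "near v e" if "p ! (l - 1) = Hub v" for v
      unfolding near_def by (rule exI[of _ "l - 1"]) (use that l1 l in \<open>auto simp: I_def\<close>)
    show ?thesis using em el ne near_m near_l by auto
  qed
  have deg: "card {z \<in> S. F v z} < k" if v: "v \<in> S - W" for v
  proof -
    define far where "far e = (if fst e = v then snd e else fst e)" for e
    have inc: "e \<notin> bad" if "fst e = v \<or> snd e = v" for e
      using that v unfolding W_def by blast
    have sub: "{z \<in> S. F v z} \<subseteq> far ` {e. near v e}"
    proof
      fix z assume "z \<in> {z \<in> S. F v z}"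
      then consider "(v, z) \<in> visited" | "(z, v) \<in> visited" unfolding F_def by blast
      then show "z \<in> far ` {e. near v e}"
      proof cases
        case 1
        then have "near v (v, z)" using near[of "(v, z)"] inc[of "(v, z)"] by auto
        then show ?thesis by (intro image_eqI[of _ _ "(v, z)"]) (auto simp: far_def)
      next
        case 2
        then have "near v (z, v)" using near[of "(z, v)"] inc[of "(z, v)"] by auto
        then show ?thesis by (intro image_eqI[of _ _ "(z, v)"]) (auto simp: far_def)
      qed
    qed
    have "\<exists>e1 e2. {e. near v e} \<subseteq> {e1, e2}"
    proof (cases "\<exists>i < length p. p ! i = Hub v")
      case True
      then obtain i where i: "i < length p" "p ! i = Hub v" by blast
      have "{e. near v e} \<subseteq> {the (block (p ! Suc i)), the (block (p ! (i - 1)))}"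
      proof
        fix e assume "e \<in> {e. near v e}"
        then obtain j where j: "j < length p" "p ! j = Hub v"
          "Suc j < length p \<and> block (p ! Suc j) = Some e \<or> 0 < j \<and> block (p ! (j - 1)) = Some e"
          unfolding near_def by blast
        then have "j = i" using i nth_eq_iff_index_eq[OF p(1)] by metis
        then show "e \<in> {the (block (p ! Suc i)), the (block (p ! (i - 1)))}" using j(3) by auto
      qed
      then show ?thesis by blast
    next
      case False
      then show ?thesis unfolding near_def by blast
    qed
    then obtain e1 e2 where "{e. near v e} \<subseteq> {e1, e2}" by blast
    then have "{z \<in> S. F v z} \<subseteq> {far e1, far e2}" using sub by blast
    then have "card {z \<in> S. F v z} \<le> card {far e1, far e2}" by (intro card_mono) auto
    also have "\<dots> \<le> 2" by (simp add: card_insert_if)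
    finally show ?thesis using k by simp
  qed
  obtain \<phi> where \<phi>: "proper_on F S \<phi>" "\<phi> ` S \<subseteq> {..<k}"
    using greedy_extension[OF finS WS colW symF irrF deg] unfolding colorable_on_def by blast
  show thesis
  proof (rule that[of \<phi>])
    fix x e assume "x \<in> set p" "block x = Some e"
    then have "e \<in> visited" unfolding visited_def by blast
    then show "\<phi> (fst e) \<noteq> \<phi> (snd e)"
      using \<phi>(1) vis[of e] unfolding proper_on_def F_def by simp
  qed (use \<phi>(2) in auto)
qed

text \<open>
  For \<open>b = 0\<close> this is the bound on the chromatic number along paths; larger \<open>b\<close> are needed for the
  induction.
\<close>

definition path_colorable :: "('a \<Rightarrow> 'a \<Rightarrow> bool) \<Rightarrow> 'a set \<Rightarrow> nat \<Rightarrow> nat \<Rightarrow> bool" where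
  "path_colorable E V b r \<longleftrightarrow>
     (\<forall>p. distinct p \<and> set p \<subseteq> V \<and> breaks E p \<le> b \<longrightarrow> colorable_on E (set p) r)"

text \<open>
  Colour the hubs as in \<open>color_hubs\<close> and let \<open>Lft\<close> and \<open>Rgt\<close> exchange the colours of their ends.
  The vertices of a copy of \<open>E\<close> keep \<open>r\<close> colours.  This is enough, as leaving the copy means to
  step onto one of four vertices, so the part of \<open>p\<close> within it has at most \<open>b + 4\<close> breaks.
\<close>

lemma path_colorable_blocks:
  fixes A :: "'s \<Rightarrow> 's \<Rightarrow> bool" and E :: "'b \<Rightarrow> 'b \<Rightarrow> bool"
  assumes finS: "finite S"
    and loc: "\<And>U. U \<subseteq> S \<Longrightarrow> card U \<le> 4 * b + 4 \<Longrightarrow> colorable_on A U 4"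
    and G: "path_colorable E V (b + 4) r"
    and sym: "symp E"
    and r: "2 \<le> r"
  shows "path_colorable (adj E) (vertices A S V) b (r + 2)"
  unfolding path_colorable_def
proof (intro allI impI, elim conjE)
  fix p :: "('s, 'b) vertex list"
  assume p: "distinct p" "set p \<subseteq> vertices A S V" "breaks (adj E) p \<le> b"
  have loc': "colorable_on A U (r + 2)" if "U \<subseteq> S" "card U \<le> 4 * b + 4" for U
    using colorable_on_mono[OF loc[OF that]] r by simp
  have k3: "3 \<le> r + 2" using r by simp
  obtain \<phi> where \<phi>: "\<And>s. s \<in> S \<Longrightarrow> \<phi> s < r + 2"
    "\<And>x e. x \<in> set p \<Longrightarrow> block x = Some e \<Longrightarrow> \<phi> (fst e) \<noteq> \<phi> (snd e)"
    using color_hubs[OF p finS loc' k3] by blast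
  have "\<exists>d. (\<forall>g. Inn e g \<in> set p \<longrightarrow> d g \<in> {..<r + 2} - {\<phi> (fst e), \<phi> (snd e)}) \<and>
      (\<forall>g h. Inn e g \<in> set p \<longrightarrow> Inn e h \<in> set p \<longrightarrow> E g h \<longrightarrow> d g \<noteq> d h)" for e
  proof (cases "\<exists>g. Inn e g \<in> set p")
    case True
    then obtain g0 where g0: "Inn e g0 \<in> set p" by blast
    then have "Inn e g0 \<in> vertices A S V" using p(2) by blast
    then have e: "fst e \<in> S" "snd e \<in> S" using vertices_block[of "Inn e g0"] by auto
    have ne: "\<phi> (fst e) \<noteq> \<phi> (snd e)" using \<phi>(2)[OF g0] by simp
    define P :: "('s, 'b) vertex \<Rightarrow> bool" where "P x \<longleftrightarrow> (\<exists>g. x = Inn e g)" for x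
    define inner where "inner x = (case x of Inn e g \<Rightarrow> g | _ \<Rightarrow> undefined)" for x :: "('s, 'b) vertex"
    have inner [simp]: "inner (Inn e' g) = g" for e' g by (simp add: inner_def)
    define q where "q = map inner (filter P p)"
    have P: "x = Inn e (inner x)" if "P x" for x using that by (auto simp: P_def)
    have setq: "g \<in> set q \<longleftrightarrow> Inn e g \<in> set p" for g
      unfolding q_def by (force simp: P_def)
    have "inj_on inner (set (filter P p))" by (rule inj_onI) (auto simp: P_def)
    then have "distinct q" using p(1) by (simp add: q_def distinct_map)
    moreover have "set q \<subseteq> V" using p(2) setq by (force simp: vertices_def)
    moreover have "breaks E q \<le> b + 4"
    proof -
      have "breaks E q = breaks (adj E) (filter P p)"
        unfolding q_def by (rule breaks_map_cong) (use sym in \<open>auto simp: P_def adj_def dest: sympD\<close>)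
      also have "\<dots> \<le> breaks (adj E) p + card {Hub (fst e), Hub (snd e), Lft e, Rgt e :: ('s, 'b) vertex}"
      proof (rule breaks_filter_distinct[OF _ p(1)])
        fix x y assume "adj E x y" "P x" "\<not> P y"
        then show "y \<in> {Hub (fst e), Hub (snd e), Lft e, Rgt e}"
          by (cases y) (auto simp: P_def adj_def)
      qed simp
      also have "card {Hub (fst e), Hub (snd e), Lft e, Rgt e :: ('s, 'b) vertex} \<le> 4"
        by (rule order_trans[OF card_insert_le_m1]) (auto simp: card_insert_if)
      finally show ?thesis using p(3) by simp
    qed
    ultimately have "colorable_on E (set q) r" using G unfolding path_colorable_def by blast
    then obtain d where d: "proper_on E (set q) d" "d ` set q \<subseteq> {..<r}"
      unfolding colorable_on_def by blast
    have "card ({..<r + 2} - {\<phi> (fst e), \<phi> (snd e)}) = r"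
      using \<phi>(1) e ne by (subst card_Diff_subset) auto
    then obtain h where h: "inj_on h {..<r}" "h ` {..<r} \<subseteq> {..<r + 2} - {\<phi> (fst e), \<phi> (snd e)}"
      using card_le_inj[of "{..<r}" "{..<r + 2} - {\<phi> (fst e), \<phi> (snd e)}"] by auto
    show ?thesis
    proof (rule exI[of _ "h \<circ> d"], intro conjI allI impI)
      fix g assume "Inn e g \<in> set p"
      then show "(h \<circ> d) g \<in> {..<r + 2} - {\<phi> (fst e), \<phi> (snd e)}"
        using h(2) d(2) setq by (metis comp_apply image_subset_iff)
    next
      fix g g' assume "Inn e g \<in> set p" "Inn e g' \<in> set p" "E g g'"
      then have "g \<in> set q" "g' \<in> set q" "d g \<noteq> d g'" using d(1) setq unfolding proper_on_def by auto
      then show "(h \<circ> d) g \<noteq> (h \<circ> d) g'" using h(1) d(2) by (metis comp_apply image_subset_iff inj_onD)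
    qed
  qed auto
  then obtain d where d: "\<And>e g. Inn e g \<in> set p \<Longrightarrow> d e g \<in> {..<r + 2} - {\<phi> (fst e), \<phi> (snd e)}"
    "\<And>e g h. Inn e g \<in> set p \<Longrightarrow> Inn e h \<in> set p \<Longrightarrow> E g h \<Longrightarrow> d e g \<noteq> d e h"
    by metis
  define f where "f x = (case x of Hub s \<Rightarrow> \<phi> s | Lft e \<Rightarrow> \<phi> (snd e) | Rgt e \<Rightarrow> \<phi> (fst e) | Inn e g \<Rightarrow> d e g)" for x
  have lft: "\<phi> (fst e) \<noteq> \<phi> (snd e)" if "Lft e \<in> set p" for e
    using that \<phi>(2)[of "Lft e" e] by simp
  have rgt: "\<phi> (fst e) \<noteq> \<phi> (snd e)" if "Rgt e \<in> set p" for e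
    using that \<phi>(2)[of "Rgt e" e] by simp
  have inn: "d e g \<noteq> \<phi> (fst e)" "d e g \<noteq> \<phi> (snd e)" if "Inn e g \<in> set p" for e g
    using d(1)[OF that] by auto
  have link: "f x \<noteq> f y" if "x \<in> set p" "y \<in> set p" "link E x y" for x y
    using that(3,1,2)
  proof (elim link.elims(2))
  qed (auto simp: f_def dest: lft rgt inn d(2))
  show "colorable_on (adj E) (set p) (r + 2)"
    unfolding colorable_on_def
  proof (rule exI[of _ f], rule conjI)
    show "proper_on (adj E) (set p) f" unfolding proper_on_def adj_def using link by metis
    show "f ` set p \<subseteq> {..<r + 2}"
    proof (rule image_subsetI)
      fix x assume x: "x \<in> set p"
      then have "x \<in> vertices A S V" using p(2) by blast
      show "f x \<in> {..<r + 2}"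
      proof (cases x)
        case (Hub s)
        then have "s \<in> S" using \<open>x \<in> vertices A S V\<close> by (auto simp: vertices_def)
        then show ?thesis using \<phi>(1) Hub by (simp add: f_def)
      next
        case (Lft e)
        then show ?thesis
          using \<phi>(1)[of "snd e"] vertices_block(2)[OF \<open>x \<in> vertices A S V\<close>, of e] by (simp add: f_def)
      next
        case (Rgt e)
        then show ?thesis
          using \<phi>(1)[of "fst e"] vertices_block(1)[OF \<open>x \<in> vertices A S V\<close>, of e] by (simp add: f_def)
      next
        case (Inn e g)
        then show ?thesis using d(1)[of e g] x by (simp add: f_def)
      qed
    qed
  qed
qed


section \<open>The iterated construction\<close>

definition finite_graph :: "('a \<Rightarrow> 'a \<Rightarrow> bool) \<Rightarrow> 'a set \<Rightarrow> bool" where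
  "finite_graph E V \<longleftrightarrow> finite V \<and> symp E \<and> irreflp E"

text \<open>
  The step of the construction changes the type of the vertices; returning to \<^typ>\<open>nat\<close> each
  time allows it to be iterated.
\<close>

lemma transfer_to_nat:
  fixes E :: "'a \<Rightarrow> 'a \<Rightarrow> bool"
  assumes G: "finite_graph E V"
  obtains E' :: "nat \<Rightarrow> nat \<Rightarrow> bool" and V' where "finite_graph E' V'"
    and "\<And>k. colorable_on E' V' k \<Longrightarrow> colorable_on E V k"
    and "\<And>b r. path_colorable E V b r \<Longrightarrow> path_colorable E' V' b r"
proof -
  obtain h :: "'a \<Rightarrow> nat" where h: "inj_on h V"
    using finite_imp_inj_to_nat_seg[of V] G unfolding finite_graph_def by blast
  define g where "g = the_inv_into V h"
  have gh: "g (h x) = x" if "x \<in> V" for x using h that by (simp add: g_def the_inv_into_f_f)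
  define E' where "E' x y \<longleftrightarrow> E (g x) (g y)" for x y
  show thesis
  proof (rule that[of E' "h ` V"])
    \<comment> \<open>Irreflexivity and symmetry hold on the whole type, as \<open>E\'\<close> is an inverse image under \<open>g\<close>.\<close>
    show "finite_graph E' (h ` V)"
      using G unfolding finite_graph_def E'_def
      by (auto intro!: sympI irreflpI dest: sympD irreflpD)
  next
    fix k assume "colorable_on E' (h ` V) k"
    then show "colorable_on E V k"
      by (rule colorable_on_vimage[of _ _ _ h]) (auto simp: E'_def gh)
  next
    fix b r assume pc: "path_colorable E V b r"
    show "path_colorable E' (h ` V) b r"
      unfolding path_colorable_def
    proof (intro allI impI, elim conjE)
      fix p assume p: "distinct p" "set p \<subseteq> h ` V" "breaks E' p \<le> b"
      have inj: "inj_on g (h ` V)" by (rule inj_onI) (auto simp: gh)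
      then have "inj_on g (set p)" using p(2) by (rule inj_on_subset)
      then have "distinct (map g p)" using p(1) by (simp add: distinct_map)
      moreover have "set (map g p) \<subseteq> V" using p(2) gh by auto
      moreover have "breaks E (map g p) = breaks E' p" by (rule breaks_map_cong) (simp add: E'_def)
      ultimately have "colorable_on E (set (map g p)) r"
        using pc p(3) unfolding path_colorable_def by metis
      then show "colorable_on E' (set p) r"
        by (rule colorable_on_vimage[of _ _ _ g]) (auto simp: E'_def)
    qed
  qed
qed

text \<open>
  The number \<open>b\<close> is universally quantified because the graph of the previous step must tolerate
  \<open>b + 4\<close> breaks.  For \<open>r = 0\<close>, truncated subtraction turns the bound \<open>- 1\<close> into the bound 0.
\<close>

lemma exists_path_colorable_graph:
  "\<exists>(E :: nat \<Rightarrow> nat \<Rightarrow> bool) V. finite_graph E V \<and> path_colorable E V b r \<and>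
     (\<forall>k. colorable_on E V k \<longrightarrow> 3 * r div 2 - 1 \<le> k)"
proof (induction r arbitrary: b rule: less_induct)
  case (less r)
  show ?case
  proof (cases "r < 4")
    case True
    have "r \<le> k" if "colorable_on (\<noteq>) {..<r} k" for k
    proof -
      obtain f where f: "proper_on (\<noteq>) {..<r} f" "f ` {..<r} \<subseteq> {..<k}"
        using \<open>colorable_on (\<noteq>) {..<r} k\<close> unfolding colorable_on_def by blast
      then have "inj_on f {..<r}" unfolding proper_on_def inj_on_def by blast
      then show ?thesis using card_inj_on_le[OF _ f(2)] by simp
    qed
    moreover have "3 * r div 2 - 1 \<le> r" using True by linarith
    moreover have "path_colorable (\<noteq>) {..<r} b r"
      unfolding path_colorable_def colorable_on_def proper_on_def by (metis image_ident)
    moreover have "finite_graph (\<noteq>) {..<r}"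
      by (auto simp: finite_graph_def intro!: sympI irreflpI)
    ultimately show ?thesis by (metis order_trans)
  next
    case False
    then obtain s where s: "r = s + 2" "2 \<le> s" using that[of "r - 2"] by simp
    define c where "c = 3 * s div 2 - 1"
    obtain E :: "nat \<Rightarrow> nat \<Rightarrow> bool" and V where G: "finite_graph E V" "path_colorable E V (b + 4) s"
      "\<And>k. colorable_on E V k \<Longrightarrow> c \<le> k"
      using less.IH[of s "b + 4"] s(1) unfolding c_def by auto
    obtain S where S: "finite S" "\<not> colorable_on shift S (c + 2)"
      "\<And>U. U \<subseteq> S \<Longrightarrow> card U \<le> 4 * b + 4 \<Longrightarrow> colorable_on shift U 4"
      using locally_four_colorable[of "c + 2" "4 * b + 4"] by blast
    note fg = G(1)[unfolded finite_graph_def]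
    have "finite_graph (adj E) (vertices shift S V)"
      using fg S(1) by (simp add: finite_graph_def finite_vertices symp_adj irreflp_adj)
    then obtain E' :: "nat \<Rightarrow> nat \<Rightarrow> bool" and V' where G': "finite_graph E' V'"
      "\<And>k. colorable_on E' V' k \<Longrightarrow> colorable_on (adj E) (vertices shift S V) k"
      "\<And>b r. path_colorable (adj E) (vertices shift S V) b r \<Longrightarrow> path_colorable E' V' b r"
      by (rule transfer_to_nat) (rule that; blast)
    have "path_colorable E' V' b r"
      unfolding s(1) by (intro G'(3) path_colorable_blocks S G s) (use fg in auto)
    moreover have "3 * r div 2 - 1 \<le> k" if "colorable_on E' V' k" for k
    proof -
      have "c + 3 \<le> k"
        by (rule more_colors_needed[OF _ S(1) S(2) G(3) _ G'(2)[OF that]]) (use fg in auto)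
      moreover have "3 * r div 2 - 1 = c + 3" using s by (simp add: c_def)
      ultimately show ?thesis by simp
    qed
    ultimately show ?thesis using G'(1) by blast
  qed
qed

section \<open>Translation to digraphs\<close>

definition digraph_of :: "(nat \<Rightarrow> nat \<Rightarrow> bool) \<Rightarrow> nat set \<Rightarrow> (nat, nat \<times> nat) pre_digraph" where
  "digraph_of E V = \<lparr>verts = V, arcs = {(x, y). x \<in> V \<and> y \<in> V \<and> E x y}, tail = fst, head = snd\<rparr>"

lemma dominates_digraph_of: "x \<rightarrow>\<^bsub>digraph_of E V\<^esub> y \<longleftrightarrow> x \<in> V \<and> y \<in> V \<and> E x y"
  by (auto simp: digraph_of_def arcs_ends_def arc_to_ends_def)

lemma graph_digraph_of:
  assumes "finite_graph E V"
  shows "graph (digraph_of E V)"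
proof
  have *: "finite V" "symp E" "irreflp E" using assms by (auto simp: finite_graph_def)
  show "finite (verts (digraph_of E V))" using * by (simp add: digraph_of_def)
  show "finite (arcs (digraph_of E V))"
    by (rule finite_subset[of _ "V \<times> V"]) (use * in \<open>auto simp: digraph_of_def\<close>)
  show "symmetric (digraph_of E V)"
    unfolding symmetric_def by (rule symI) (use * in \<open>auto simp: dominates_digraph_of dest: sympD\<close>)
qed (use assms in \<open>auto simp: digraph_of_def finite_graph_def arc_to_ends_def dest: irreflpD\<close>)

lemma colorable_digraph_of: "colorable (digraph_of E V) k \<longleftrightarrow> colorable_on E V k"
  unfolding colorable_def colorable_on_def proper_coloring_def proper_on_def dominates_digraph_of
  by (auto simp: digraph_of_def)

lemma induce_digraph_of: "X \<subseteq> V \<Longrightarrow> digraph_of E V \<restriction> X = digraph_of E X"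
  by (auto simp: digraph_of_def induce_subgraph_def)

lemma vpath_breaks: "vpath p (digraph_of E V) \<Longrightarrow> distinct p \<and> set p \<subseteq> V \<and> breaks E p = 0"
proof -
  assume "vpath p (digraph_of E V)"
  then have p: "distinct p" "set p \<subseteq> V" "set (vwalk_arcs p) \<subseteq> arcs_ends (digraph_of E V)"
    by (auto simp: vpath_def vwalk_def digraph_of_def)
  from p(3) have "breaks E p = 0"
    by (induction p rule: induct_list012) (auto simp: dominates_digraph_of)
  with p show ?thesis by blast
qed

theorem theorem1p2:
  fixes r :: nat
  shows "\<exists>G :: (nat, nat \<times> nat) pre_digraph.
           graph G \<and> path_chromatic_number G \<le> r \<and>
           int (chromatic_number G) \<ge> \<lfloor>3 * real r / 2\<rfloor> - 1"
proof -
  obtain E :: "nat \<Rightarrow> nat \<Rightarrow> bool" and V where G: "finite_graph E V" "path_colorable E V 0 r"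
    "\<And>k. colorable_on E V k \<Longrightarrow> 3 * r div 2 - 1 \<le> k"
    using exists_path_colorable_graph[of 0 r] by blast
  let ?G = "digraph_of E V"
  have graph: "graph ?G" using G(1) by (rule graph_digraph_of)
  have "chromatic_number (?G \<restriction> set p) \<le> r" if "vpath p ?G" for p
  proof -
    have "colorable_on E (set p) r"
      using vpath_breaks[OF that] G(2) unfolding path_colorable_def by simp
    then have "colorable (?G \<restriction> set p) r"
      using vpath_breaks[OF that] by (simp add: induce_digraph_of colorable_digraph_of)
    then show ?thesis unfolding chromatic_number_def by (rule Least_le)
  qed
  then have "path_chromatic_number ?G \<le> r"
    using path_chromatic_number_le_iff[OF graph] by blast
  moreover have "3 * r div 2 - 1 \<le> chromatic_number ?G"
    using G(3) colorable_chromatic_number[OF graph] by (simp add: colorable_digraph_of)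
  moreover have "\<lfloor>3 * real r / 2\<rfloor> = int (3 * r div 2)"
    using floor_divide_of_nat_eq[of "3 * r" 2, where ?'a = real] by simp
  ultimately show ?thesis using graph by (intro exI[of _ ?G]) linarith
qed

end
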